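(* Let $p\ge 1$ and let $L$ be a symmetric convex body in $\mathbb{R}^n$ which has at least one of the following two properties: (i) the measure $\mu$ on $\mathbb{R}^n$ with density $e^{-\|x\|_L^p}$ satisfies: for every symmetric convex body $M$ in $\mathbb{R}^n$, the function $\mathbb{R}\ni t\mapsto\mu(e^tM)$ is log-concave; (ii) the uniform measure $\mu=|L\cap\cdot\,|$ of $L$ satisfies: for every symmetric convex body $M$ in $\mathbb{R}^n$, the function $\mathbb{R}\ni t\mapsto\mu(e^tM)=|L\cap e^tM|$ is log-concave. Then, for every symmetric convex body $K$ in $\mathbb{R}^n$, the function $$\mathbb{R}\ni t\mapsto\big|(K^{\circ}+_p e^t\cdot L^{\circ})^{\circ}\big|$$ is log-concave.
   Context: A convex body in $\mathbb{R}^n$ is a compact convex set with non-empty interior; it is symmetric if $K=-K$. $|\cdot|$ is Lebesgue measure. $\|\cdot\|_K$ is the norm whose unit ball is the symmetric convex body $K$. The support function is $h_K(x)=\max_{y\in K}x\cdot y$ and the polar body is $K^{\circ}=\{x: x\cdot y\le 1\ \forall y\in K\}$; one has $h_{K^\circ}=\|\cdot\|_{K}$. For $p\ge1$, $a,b>0$ and convex bodies $K,L$ containing the origin in their interiors, $a\cdot K+_p b\cdot L$ is the convex body with support function $(a h_K^p+b h_L^p)^{1/p}$ (so $K+_p b\cdot L$ has support function $(h_K^p+b h_L^p)^{1/p}$). A non-negative function is log-concave if its logarithm (with values in $[-\infty,\infty)$) is concave. *)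

theory Defs
  imports "HOL-Analysis.Analysis"
begin

definition convex_body :: "(real ^ 'n) set \<Rightarrow> bool" where
  "convex_body K \<longleftrightarrow> compact K \<and> convex K \<and> interior K \<noteq> {}"

definition symmetric_convex_body :: "(real ^ 'n) set \<Rightarrow> bool" where
  "symmetric_convex_body K \<longleftrightarrow> convex_body K \<and> K = uminus ` K"

(* The norm with unit ball K, as the Minkowski functional of K. *)
definition body_norm :: "(real ^ 'n) set \<Rightarrow> real ^ 'n \<Rightarrow> real" where
  "body_norm K x = Inf {r. 0 < r \<and> x \<in> (\<lambda>y. r *\<^sub>R y) ` K}"

(* For nonempty compact K the supremum is attained, so it is the maximum. *)
definition support_fun :: "(real ^ 'n) set \<Rightarrow> real ^ 'n \<Rightarrow> real" where
  "support_fun K x = (SUP y\<in>K. x \<bullet> y)"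

definition polar_body :: "(real ^ 'n) set \<Rightarrow> (real ^ 'n) set" where
  "polar_body K = {x. \<forall>y\<in>K. x \<bullet> y \<le> 1}"

(* The combination a . K +_p b . L.  The description is only meaningful for p >= 1, a, b > 0
   and convex bodies K, L with the origin in their interiors. *)
definition Lp_sum :: "real \<Rightarrow> real \<Rightarrow> (real ^ 'n) set \<Rightarrow> real \<Rightarrow> (real ^ 'n) set \<Rightarrow> (real ^ 'n) set" where
  "Lp_sum p a K b L =
     (THE M. convex_body M \<and>
        (\<forall>x. support_fun M x =
           (a * support_fun K x powr p + b * support_fun L x powr p) powr (1 / p)))"

(* Unlike ln on the reals, where ln 0 = 0, this has log 0 = -infinity. *)
definition ext_ln :: "real \<Rightarrow> ereal" where
  "ext_ln r = (if 0 < r then ereal (ln r) else - \<infinity>)"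

(* Since ext_ln never takes the value infinity, no undefined sum occurs;
   the products 0 * (- infinity) = 0 for u = 0 or v = 0 only give trivial inequalities. *)
definition log_concave :: "('a::real_vector \<Rightarrow> real) \<Rightarrow> bool" where
  "log_concave f \<longleftrightarrow> (\<forall>x. 0 \<le> f x) \<and>
     (\<forall>x y u v. 0 \<le> u \<longrightarrow> 0 \<le> v \<longrightarrow> u + v = 1 \<longrightarrow>
        ereal u * ext_ln (f x) + ereal v * ext_ln (f y) \<le> ext_ln (f (u *\<^sub>R x + v *\<^sub>R y)))"

end

theory Submission
  imports Defs
begin

text \<open>
  Write \<open>N\<close> for the gauge of a symmetric convex body. The polar of the \<open>L\<^sub>p\<close> sum is the ball
  \<open>Q\<^sub>t = {N\<^sub>K\<^sup>p + e\<^sup>t N\<^sub>L\<^sup>p \<le> 1}\<close>. The layer-cake identity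
  \<open>\<integral> exp (- \<phi>) d\<mu> = \<integral> \<mu> {\<phi> \<le> e\<^sup>u} exp (u - e\<^sup>u) du\<close>, applied to
  \<open>e\<^bsup>-t\<^esup> N\<^sub>K\<^sup>p + N\<^sub>L\<^sup>p\<close> under Lebesgue measure and to \<open>e\<^bsup>-t\<^esup> N\<^sub>K\<^sup>p\<close> under
  \<open>d\<mu> = exp (- N\<^sub>L\<^sup>p) dx\<close>, gives
  \<open>\<Gamma>(n/p + 1) e\<^bsup>nt/p\<^esup> |Q\<^sub>t| = \<integral> \<mu>(e\<^bsup>(t+u)/p\<^esup> K) exp (u - e\<^sup>u) du\<close>.
  Under (i) the integrand is jointly log-concave in \<open>(t, u)\<close>, so the one-dimensional
  Prekopa-Leindler inequality gives the claim. The same identity writes \<open>\<mu>(e\<^sup>t M)\<close> as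
  \<open>\<integral> |L \<inter> e\<^bsup>t-u/p\<^esup> M| exp (n u / p + u - e\<^sup>u) du\<close>, so (ii) implies (i).
\<close>

section \<open>The one-dimensional Prekopa-Leindler inequality\<close>

text \<open>Splitting off the tail up to \<open>x - 1\<close> as a constant leaves an integral over
  a compact interval, where the fundamental theorem of calculus applies.\<close>

lemma cdf_has_real_derivative:
  fixes f :: "real \<Rightarrow> real"
  assumes cont: "continuous_on UNIV f" and int: "integrable lborel f"
  shows "((\<lambda>x. LINT y|lborel. indicator {..x} y *\<^sub>R f y) has_real_derivative f x) (at x)"
proof -
  define F where "F x = (LINT y|lborel. indicator {..x} y *\<^sub>R f y)" for x
  have si: "set_integrable lborel A f" if "A \<in> sets borel" for A
    unfolding set_integrable_def
    using int that by (intro integrable_mult_indicator) auto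
  have eq: "F z = F (x - 1) + integral {x - 1..z} f" if "x - 1 \<le> z" for z
  proof -
    have "F z = (LINT y:{..z}|lborel. f y)" by (simp add: F_def set_lebesgue_integral_def)
    also have "{..z} = {..x - 1} \<union> {x - 1<..z}" using that by auto
    also have "(LINT y:{..x - 1} \<union> {x - 1<..z}|lborel. f y) =
      (LINT y:{..x - 1}|lborel. f y) + (LINT y:{x - 1<..z}|lborel. f y)"
      by (intro set_integral_Un si) auto
    also have "(LINT y:{..x - 1}|lborel. f y) = F (x - 1)"
      by (simp add: F_def set_lebesgue_integral_def)
    also have "(LINT y:{x - 1<..z}|lborel. f y) = integral {x - 1<..z} f"
      by (intro set_borel_integral_eq_integral si) auto
    also have "\<dots> = integral {x - 1..z} f"
      by (rule integral_subset_negligible) (auto intro: negligible_subset[of "{x - 1}"])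
    finally show ?thesis .
  qed
  have "((\<lambda>z. integral {x - 1..z} f) has_real_derivative f x) (at x within {x - 1..x + 1})"
    by (intro integral_has_real_derivative continuous_on_subset[OF cont]) auto
  then have "((\<lambda>z. integral {x - 1..z} f) has_real_derivative f x) (at x)"
    by (simp add: at_within_Icc_at)
  then have "((\<lambda>z. F (x - 1) + integral {x - 1..z} f) has_real_derivative f x) (at x)"
    by (auto intro!: derivative_eq_intros)
  then have "(F has_real_derivative f x) (at x)"
    by (rule has_field_derivative_transform_within_open[where S = "{x - 1<..}"])
       (auto simp flip: eq)
  then show ?thesis unfolding F_def[abs_def] .
qed

lemma cdf_tendsto_at_bot:
  fixes f :: "real \<Rightarrow> real"
  assumes int: "integrable lborel f"
  shows "((\<lambda>x. LINT y|lborel. indicator {..x} y *\<^sub>R f y) \<longlongrightarrow> 0) at_bot"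
proof -
  have [measurable]: "f \<in> borel_measurable borel"
    using int by auto
  have "((\<lambda>x. LINT y|lborel. indicator {..x} y *\<^sub>R f y) \<longlongrightarrow> (LINT (y::real)|lborel. (0::real))) at_bot"
    unfolding filterlim_at_bot_mirror
  proof (rule integral_dominated_convergence_at_top[where w = "\<lambda>y. \<bar>f y\<bar>"])
    show "\<forall>\<^sub>F i in at_top. AE x in lborel. norm (indicator {..- i} x *\<^sub>R f x) \<le> \<bar>f x\<bar>"
      by (intro always_eventually allI AE_I2) (auto simp: indicator_def)
    show "AE x in lborel. ((\<lambda>i. indicator {..- i} x *\<^sub>R f x) \<longlongrightarrow> 0) at_top"
    proof (intro AE_I2 tendsto_eventually)
      fix x
      show "\<forall>\<^sub>F i in at_top. indicator {..- i} x *\<^sub>R f x = 0"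
        using eventually_gt_at_top[of "- x"] by eventually_elim (auto simp: indicator_def)
    qed
  qed (use int in auto)
  then show ?thesis by simp
qed

lemma integral_pos_of_pos:
  fixes f :: "real \<Rightarrow> real"
  assumes int: "integrable lborel f" and pos: "\<And>x. 0 < f x"
  shows "0 < integral\<^sup>L lborel f"
proof -
  have "integral\<^sup>L lborel f \<noteq> 0"
  proof
    assume "integral\<^sup>L lborel f = 0"
    then have "AE x in lborel. f x = 0"
      using integral_nonneg_eq_0_iff_AE[OF int] pos by (simp add: less_imp_le)
    then have "AE x in lborel :: real measure. False"
      by eventually_elim (use pos in \<open>metis less_irrefl\<close>)
    \<comment> \<open>Otherwise the whole line would be a null set for
      \<open>lborel\<close>.\<close>
    then show False
      using AE_iff_measurable[of UNIV lborel "\<lambda>_::real. False"] by simp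
  qed
  moreover have "0 \<le> integral\<^sup>L lborel f"
    using pos by (intro integral_nonneg_AE) (auto simp: less_imp_le)
  ultimately show ?thesis by simp
qed

text \<open>The witness is the inverse of the normalised distribution function \<open>F\<close>,
  whose derivative is positive because \<open>f\<close> is. The values 0 and 1 are only limits of
  \<open>F\<close>, hence the open interval.\<close>

lemma quantile_function_exists:
  fixes f :: "real \<Rightarrow> real"
  assumes cont: "continuous_on UNIV f" and int: "integrable lborel f" and pos: "\<And>x. 0 < f x"
  obtains X where "\<And>s. 0 < s \<Longrightarrow> s < 1 \<Longrightarrow>
    (X has_real_derivative integral\<^sup>L lborel f / f (X s)) (at s)"
proof -
  define I where "I = integral\<^sup>L lborel f"
  have I: "0 < I" unfolding I_def by (rule integral_pos_of_pos[OF int pos])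
  define F where "F x = (LINT y|lborel. indicator {..x} y *\<^sub>R f y) / I" for x
  have der: "(F has_real_derivative f x / I) (at x)" for x
    unfolding F_def[abs_def]
    by (intro DERIV_cdivide cdf_has_real_derivative cont int)
  have F_cont: "isCont F x" for x using der DERIV_isCont by blast
  have mono: "F x < F y" if "x < y" for x y
  proof (rule DERIV_pos_imp_increasing[OF that])
    fix z show "\<exists>d. (F has_real_derivative d) (at z) \<and> 0 < d"
      using der[of z] pos[of z] I by (intro exI[of _ "f z / I"]) auto
  qed
  have inj: "inj F" by (intro linorder_injI) (auto dest: mono)
  have top: "(F \<longlongrightarrow> 1) at_top"
  proof -
    have "(F \<longlongrightarrow> I / I) at_top"
      unfolding F_def[abs_def] I_def
      by (intro tendsto_divide tendsto_integral_at_top tendsto_const int) (use I I_def in auto)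
    then show ?thesis using I by simp
  qed
  have bot: "(F \<longlongrightarrow> 0) at_bot"
    unfolding F_def[abs_def] using tendsto_divide[OF cdf_tendsto_at_bot[OF int] tendsto_const, of I] I
    by simp
  have surj: "\<exists>x. F x = s" if s: "0 < s" "s < 1" for s
  proof -
    obtain a where a: "F a < s"
      using order_tendstoD(2)[OF bot s(1)] by (auto simp: eventually_at_bot_linorder)
    obtain b where b: "s < F b"
      using order_tendstoD(1)[OF top s(2)] by (auto simp: eventually_at_top_linorder)
    have "a \<le> b" using a b mono[of b a] by (cases "b < a") auto
    then show ?thesis
      using IVT[of F a s b] a b F_cont by (auto simp: less_imp_le)
  qed
  have FX: "F (inv F s) = s" if "0 < s" "s < 1" for s
    using surj[OF that] by (auto simp: f_inv_into_f)
  show ?thesis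
  proof (rule that[of "inv F"])
    fix s :: real assume s: "0 < s" "s < 1"
    \<comment> \<open>\<open>inv F\<close> is a left inverse of \<open>F\<close> on the whole line,
      so the radius 1 is an arbitrary choice.\<close>
    have "isCont (inv F) (F (inv F s))"
      by (rule isCont_inverse_function[of 1]) (auto simp: inj F_cont)
    then have "isCont (inv F) s" using FX[OF s] by simp
    then have "(inv F has_real_derivative inverse (f (inv F s) / I)) (at s)"
      using pos[of "inv F s"] I s FX by (intro DERIV_inverse_function[OF der, of _ _ 0 1]) auto
    then show "(inv F has_real_derivative integral\<^sup>L lborel f / f (inv F s)) (at s)"
      by (simp add: I_def)
  qed
qed

text \<open>Transport proof: quantile functions carry the uniform law on (0, 1) to the normalised
  \<open>f\<close> and \<open>g\<close>. Continuity and positivity make these maps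
  differentiable.\<close>

lemma prekopa_leindler_real:
  fixes f g h :: "real \<Rightarrow> real"
  assumes f: "continuous_on UNIV f" "integrable lborel f" "\<And>x. 0 < f x"
    and g: "continuous_on UNIV g" "integrable lborel g" "\<And>x. 0 < g x"
    and h: "integrable lborel h"
    and uv: "0 < u" "0 < v" "u + v = 1"
    and fgh: "\<And>x y. f x powr u * g y powr v \<le> h (u * x + v * y)"
  shows "integral\<^sup>L lborel f powr u * integral\<^sup>L lborel g powr v \<le> integral\<^sup>L lborel h"
proof -
  define I J where "I = integral\<^sup>L lborel f" and "J = integral\<^sup>L lborel g"
  have IJ: "0 < I" "0 < J" unfolding I_def J_def
    using integral_pos_of_pos f(2,3) g(2,3) by auto
  obtain X where X: "\<And>s. 0 < s \<Longrightarrow> s < 1 \<Longrightarrow> (X has_real_derivative I / f (X s)) (at s)"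
    unfolding I_def by (rule quantile_function_exists[OF f]) blast
  obtain Y where Y: "\<And>s. 0 < s \<Longrightarrow> s < 1 \<Longrightarrow> (Y has_real_derivative J / g (Y s)) (at s)"
    unfolding J_def by (rule quantile_function_exists[OF g]) blast
  \<comment> \<open>Substituting along \<open>Z\<close>, the average of the two quantile functions, in \<open>\<integral> h\<close> turns the
    pointwise hypothesis on \<open>h\<close> and AM-GM for \<open>Z'\<close> into a constant lower bound on \<open>(0, 1)\<close>.\<close>
  define Z where "Z s = u * X s + v * Y s" for s
  define Z' where "Z' s = u * (I / f (X s)) + v * (J / g (Y s))" for s
  let ?S = "{0<..<1::real}"
  have Z: "(Z has_real_derivative Z' s) (at s)" if "s \<in> ?S" for s
    unfolding Z_def[abs_def] Z'_def using that X Y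
    by (auto intro!: derivative_eq_intros simp: mult.commute)
  have Z'_pos: "0 < Z' s" for s
    unfolding Z'_def using uv IJ f(3) g(3) by (intro add_pos_pos mult_pos_pos divide_pos_pos) auto
  have mono: "Z s < Z r" if "s < r" "s \<in> ?S" "r \<in> ?S" for s r
  proof (rule DERIV_pos_imp_increasing[OF that(1)])
    fix x assume "s \<le> x" "x \<le> r"
    then have "x \<in> ?S" using that by auto
    then show "\<exists>d. (Z has_real_derivative d) (at x) \<and> 0 < d" using Z Z'_pos by blast
  qed
  have inj: "inj_on Z ?S"
    by (intro linorder_inj_onI) (metis mono less_irrefl, auto)
  \<comment> \<open>Being injective and continuous, \<open>Z\<close> has an open image by invariance
    of domain, so the image is Borel.\<close>
  have "continuous_on ?S Z"
    using Z by (intro continuous_at_imp_continuous_on) (blast intro: DERIV_isCont)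
  then have "open (Z ` ?S)"
    using inj by (intro invariance_of_domain_gen) auto
  then have meas: "Z ` ?S \<in> sets borel" by simp
  \<comment> \<open>Equal points in the hypothesis on \<open>h\<close> give positivity at
    \<open>z\<close>, since \<open>u + v = 1\<close>.\<close>
  have h0: "0 \<le> h z" for z
  proof -
    have "0 < f z powr u * g z powr v" using f(3)[of z] g(3)[of z] by simp
    also have "\<dots> \<le> h z" using fgh[of z z] uv(3) by (simp flip: distrib_right)
    finally show ?thesis by simp
  qed
  have hset: "set_integrable lborel A h" if "A \<in> sets borel" for A
    unfolding set_integrable_def using h that by (intro integrable_mult_indicator) auto
  have habs: "h absolutely_integrable_on (Z ` ?S)"
    using hset[OF meas] unfolding set_integrable_def
    by (subst integrable_completion) (auto dest: borel_measurable_integrable)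
  have cov: "(\<lambda>s. \<bar>Z' s\<bar> * h (Z s)) absolutely_integrable_on ?S"
    "integral ?S (\<lambda>s. \<bar>Z' s\<bar> * h (Z s)) = integral (Z ` ?S) h"
    using has_absolute_integral_change_of_variables_1'[of ?S Z Z' h "integral (Z ` ?S) h"]
      habs inj Z by (auto intro: has_field_derivative_at_within)
  have lower: "I powr u * J powr v \<le> \<bar>Z' s\<bar> * h (Z s)" for s
  proof -
    have a: "0 < f (X s)" "0 < g (Y s)" using f g by auto
    \<comment> \<open>After dividing and multiplying by the densities, Young's inequality bounds the
      first factor by \<open>Z' s\<close> and the hypothesis on \<open>h\<close> bounds the second
      by \<open>h (Z s)\<close>.\<close>
    have "I powr u * J powr v =
      ((I / f (X s)) powr u * (J / g (Y s)) powr v) * (f (X s) powr u * g (Y s) powr v)"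
      using a IJ by (simp add: powr_divide)
    also have "\<dots> \<le> Z' s * h (Z s)"
      unfolding Z'_def Z_def using a IJ uv
      by (intro mult_mono Youngs_inequality_0 fgh) auto
    finally show ?thesis using Z'_pos[of s] by simp
  qed
  have "I powr u * J powr v = integral ?S (\<lambda>s. I powr u * J powr v)"
    using integral_open_interval_real[of 0 1 "\<lambda>_. I powr u * J powr v"] by simp
  also have "\<dots> \<le> integral ?S (\<lambda>s. \<bar>Z' s\<bar> * h (Z s))"
    by (intro integral_le lower set_lebesgue_integral_eq_integral(1) cov)
       (simp add: integrable_on_open_interval_real)
  also have "\<dots> = integral (Z ` ?S) h" by (rule cov)
  also have "\<dots> \<le> integral UNIV h"
    using hset meas h0 set_borel_integral_eq_integral(1)[of UNIV h]
    by (intro integral_subset_le set_borel_integral_eq_integral(1)) auto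
  also have "\<dots> = integral\<^sup>L lborel h"
    using set_borel_integral_eq_integral(2)[of UNIV h] hset[of UNIV]
    by (simp add: set_lebesgue_integral_def)
  finally show ?thesis by (simp add: I_def J_def)
qed

section \<open>Log-concavity and exponential layer-cake integrals\<close>

text \<open>Positivity keeps \<open>ext_ln\<close> finite, so exponentiating gives the
  multiplicative form used by the Prekopa-Leindler inequality. Weights 0 and 1 give only trivial
  inequalities.\<close>

lemma log_concave_iff_powr:
  fixes f :: "'a::real_vector \<Rightarrow> real"
  assumes pos: "\<And>x. 0 < f x"
  shows "log_concave f \<longleftrightarrow>
    (\<forall>x y u v. 0 < u \<longrightarrow> 0 < v \<longrightarrow> u + v = 1 \<longrightarrow> f x powr u * f y powr v \<le> f (u *\<^sub>R x + v *\<^sub>R y))"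
proof -
  have eq: "ereal u * ext_ln (f x) + ereal v * ext_ln (f y) \<le> ext_ln (f z) \<longleftrightarrow>
    f x powr u * f y powr v \<le> f z" for x y z u v
  proof -
    have "ereal u * ext_ln (f x) + ereal v * ext_ln (f y) \<le> ext_ln (f z) \<longleftrightarrow>
      u * ln (f x) + v * ln (f y) \<le> ln (f z)"
      using pos by (simp add: ext_ln_def)
    also have "\<dots> \<longleftrightarrow> exp (u * ln (f x) + v * ln (f y)) \<le> f z"
      using pos[of z] by (metis exp_le_cancel_iff exp_ln)
    also have "exp (u * ln (f x) + v * ln (f y)) = f x powr u * f y powr v"
      using pos[of x] pos[of y] by (simp add: powr_def exp_add)
    finally show ?thesis .
  qed
  have "f x powr u * f y powr v \<le> f (u *\<^sub>R x + v *\<^sub>R y)"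
    if "0 \<le> u" "0 \<le> v" "u + v = 1" "\<not> (0 < u \<and> 0 < v)" for x y u v
  proof -
    have "u = 0 \<and> v = 1 \<or> u = 1 \<and> v = 0" using that by auto
    then show ?thesis using pos[of x] pos[of y] by auto
  qed
  then show ?thesis
    unfolding log_concave_def eq using pos by (metis less_imp_le)
qed

text \<open>The function \<open>- ln (f x)\<close> is convex and finite on the whole space, hence
  continuous. This supplies the continuity that the Prekopa-Leindler inequality asks for.\<close>

lemma log_concave_pos_continuous:
  fixes f :: "'a::euclidean_space \<Rightarrow> real"
  assumes pos: "\<And>x. 0 < f x" and lc: "log_concave f"
  shows "continuous_on UNIV f"
proof -
  have "convex_on UNIV (\<lambda>x. - ln (f x))"
  proof (rule convex_onI)
    fix t x y assume t: "0 < t" "t < (1::real)"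
    have "f x powr (1 - t) * f y powr t \<le> f ((1 - t) *\<^sub>R x + t *\<^sub>R y)"
      using lc t unfolding log_concave_iff_powr[OF pos] by simp
    then have "ln (f x powr (1 - t) * f y powr t) \<le> ln (f ((1 - t) *\<^sub>R x + t *\<^sub>R y))"
      using pos[of x] pos[of y] by (intro ln_mono) auto
    also have "ln (f x powr (1 - t) * f y powr t) = (1 - t) * ln (f x) + t * ln (f y)"
      using pos[of x] pos[of y] by (simp add: ln_mult ln_powr)
    finally show "- ln (f ((1 - t) *\<^sub>R x + t *\<^sub>R y)) \<le> (1 - t) * - ln (f x) + t * - ln (f y)"
      by simp
  qed auto
  then have "continuous_on UNIV (\<lambda>x. - ln (f x))"
    by (intro convex_on_continuous) auto
  from continuous_on_exp[OF continuous_on_minus[OF this]]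
  have "continuous_on UNIV (\<lambda>x. exp (- (- ln (f x))))" .
  moreover have "exp (- (- ln (f x))) = f x" for x using pos[of x] by simp
  ultimately show ?thesis by (simp only: cong: continuous_on_cong)
qed

text \<open>The exponential factor is log-affine. In the end this removes the Gamma constant and the
  factor \<open>exp (t * n / p)\<close>, and it passes from \<open>t\<close> to
  \<open>t / p\<close>.\<close>

lemma log_concave_times_exp:
  fixes f :: "real \<Rightarrow> real"
  assumes pos: "\<And>x. 0 < f x" and lc: "log_concave f"
  shows "log_concave (\<lambda>t. exp (k + c * t) * f (d * t))"
proof -
  have "(exp (k + c * x) * f (d * x)) powr u * (exp (k + c * y) * f (d * y)) powr v \<le>
      exp (k + c * (u * x + v * y)) * f (d * (u * x + v * y))"
    if uv: "0 < u" "0 < v" "u + v = 1" for x y u v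
  proof -
    have "(k + c * x) * u + (k + c * y) * v = k * (u + v) + c * (u * x + v * y)"
      by (simp add: algebra_simps)
    then have "exp (k + c * x) powr u * exp (k + c * y) powr v = exp (k + c * (u * x + v * y))"
      using uv by (simp add: exp_powr_real flip: exp_add)
    then have "(exp (k + c * x) * f (d * x)) powr u * (exp (k + c * y) * f (d * y)) powr v =
      exp (k + c * (u * x + v * y)) * (f (d * x) powr u * f (d * y) powr v)"
      using pos by (simp add: powr_mult less_imp_le)
    also have "\<dots> \<le> exp (k + c * (u * x + v * y)) * f (u *\<^sub>R (d * x) + v *\<^sub>R (d * y))"
      using lc uv unfolding log_concave_iff_powr[OF pos] by (intro mult_left_mono) auto
    finally show ?thesis by (simp add: algebra_simps)
  qed
  then show ?thesis
    by (subst log_concave_iff_powr) (auto simp: pos)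
qed

text \<open>The density of the logarithm of a Gamma variable of shape \<open>a + 1\<close>, up to normalisation.\<close>

definition log_gamma_weight :: "real \<Rightarrow> real \<Rightarrow> real" where
  "log_gamma_weight a u = exp (a * u + u - exp u)"

lemma log_gamma_weight_pos: "0 < log_gamma_weight a u"
  by (simp add: log_gamma_weight_def)

lemma continuous_on_log_gamma_weight: "continuous_on S (log_gamma_weight a)"
  unfolding log_gamma_weight_def[abs_def] by (intro continuous_intros)

lemma borel_measurable_log_gamma_weight [measurable]: "log_gamma_weight a \<in> borel_measurable borel"
  by (intro borel_measurable_continuous_onI continuous_on_log_gamma_weight)

text \<open>The exponent is an affine function minus the convex \<open>exp\<close>.\<close>

lemma log_gamma_weight_log_concave:
  assumes uv: "0 < u" "0 < v" "u + v = 1"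
  shows "log_gamma_weight a x powr u * log_gamma_weight a y powr v \<le> log_gamma_weight a (u * x + v * y)"
proof -
  have "exp (u * x + v * y) \<le> u * exp x + v * exp y"
    using exp_convex uv unfolding convex_on_def by simp
  moreover have "log_gamma_weight a x powr u * log_gamma_weight a y powr v =
    exp (a * (u * x + v * y) + (u * x + v * y) - (u * exp x + v * exp y))"
    by (simp add: log_gamma_weight_def exp_powr_real algebra_simps flip: exp_add)
  ultimately show ?thesis by (simp add: log_gamma_weight_def)
qed

text \<open>Euler's integral under the substitution of \<open>exp u\<close> for \<open>t\<close>;
  the Jacobian supplies the second summand \<open>u\<close> in the exponent.\<close>

lemma
  assumes a: "0 \<le> a"
  shows integrable_log_gamma_weight: "integrable lborel (log_gamma_weight a)"
    and integral_log_gamma_weight: "integral\<^sup>L lborel (log_gamma_weight a) = Gamma (a + 1)"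
proof -
  let ?f = "\<lambda>t::real. t powr (a + 1 - 1) / exp t"
  have 1: "(?f has_integral Gamma (a + 1)) {0..}"
    using a by (intro Gamma_integral_real) auto
  \<comment> \<open>The endpoint 0 is not a value of \<open>exp\<close> and is discarded as a null
    set.\<close>
  then have 2: "(?f has_integral Gamma (a + 1)) {0<..}"
    by (rule has_integral_spike_set_eq[THEN iffD1, rotated -1])
       (auto intro: negligible_subset[of "{0}"])
  then have 3: "?f absolutely_integrable_on {0<..}"
    by (intro nonnegative_absolutely_integrable_1) (auto simp: has_integral_integrable)
  have "exp ` (UNIV :: real set) = {0<..}"
    by (auto simp: image_iff) (metis exp_ln)
  then have "(\<lambda>u. \<bar>exp u\<bar> * ?f (exp u)) absolutely_integrable_on UNIV \<and>
      integral UNIV (\<lambda>u. \<bar>exp u\<bar> * ?f (exp u)) = Gamma (a + 1)"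
    using 3 2 has_absolute_integral_change_of_variables_1'[of UNIV exp exp ?f "Gamma (a + 1)"]
    by (auto simp: inj_on_def integral_unique intro: DERIV_exp)
  moreover have "(\<lambda>u. \<bar>exp u\<bar> * ?f (exp u)) = log_gamma_weight a"
    by (rule ext) (simp add: log_gamma_weight_def powr_def exp_diff exp_add)
  ultimately have 4: "log_gamma_weight a absolutely_integrable_on UNIV"
    "integral UNIV (log_gamma_weight a) = Gamma (a + 1)" by auto
  then show 5: "integrable lborel (log_gamma_weight a)"
    using integrable_completion[of "log_gamma_weight a" lborel] by (simp add: set_integrable_def)
  show "integral\<^sup>L lborel (log_gamma_weight a) = Gamma (a + 1)"
    using set_borel_integral_eq_integral(2)[of UNIV "log_gamma_weight a"] 4(2) 5
    by (simp add: set_integrable_def set_lebesgue_integral_def)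
qed

text \<open>The integrand is log-concave jointly in \<open>t\<close> and \<open>u\<close>, so
  Prekopa-Leindler applies to its marginal. The bound \<open>B\<close> gives integrability by
  domination. The coefficient \<open>b\<close> will be \<open>1 / p\<close> or its negative.\<close>

lemma log_concave_convolution:
  fixes g :: "real \<Rightarrow> real"
  assumes pos: "\<And>x. 0 < g x" and lc: "log_concave g" and bdd: "\<And>x. g x \<le> B" and a: "0 \<le> a"
  shows "integrable lborel (\<lambda>u. g (t + b * u) * log_gamma_weight a u)"
    and "0 < (LINT u|lborel. g (t + b * u) * log_gamma_weight a u)"
    and "log_concave (\<lambda>t. LINT u|lborel. g (t + b * u) * log_gamma_weight a u)"
proof -
  define f where "f t u = g (t + b * u) * log_gamma_weight a u" for t u
  have f_pos: "0 < f t u" for t u using pos log_gamma_weight_pos by (simp add: f_def)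
  have g_cont: "continuous_on UNIV g" by (rule log_concave_pos_continuous[OF pos lc])
  have f_cont: "continuous_on UNIV (f t)" for t
    unfolding f_def[abs_def]
    by (intro continuous_intros continuous_on_log_gamma_weight continuous_on_compose2[OF g_cont]) auto
  have f_int: "integrable lborel (f t)" for t
  proof (rule Bochner_Integration.integrable_bound)
    show "integrable lborel (\<lambda>u. B * log_gamma_weight a u)"
      using integrable_log_gamma_weight[OF a] by simp
    show "f t \<in> borel_measurable lborel"
      using borel_measurable_continuous_onI[OF f_cont] by simp
    have "norm (f t u) \<le> norm (B * log_gamma_weight a u)" for u
    proof -
      have "0 < B" using pos[of 0] bdd[of 0] by simp
      then show ?thesis using pos[of "t + b * u"] bdd[of "t + b * u"] log_gamma_weight_pos[of a u]
        by (simp add: f_def abs_mult)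
    qed
    then show "AE u in lborel. norm (f t u) \<le> norm (B * log_gamma_weight a u)" by simp
  qed
  have I_pos: "0 < integral\<^sup>L lborel (f t)" for t
    by (rule integral_pos_of_pos[OF f_int f_pos])
  have key: "f s x powr u * f t y powr v \<le> f (u * s + v * t) (u * x + v * y)"
    if uv: "0 < u" "0 < v" "u + v = 1" for s t x y u v
  proof -
    have "f s x powr u * f t y powr v = (g (s + b * x) powr u * g (t + b * y) powr v) *
      (log_gamma_weight a x powr u * log_gamma_weight a y powr v)"
      using pos log_gamma_weight_pos by (simp add: f_def powr_mult less_imp_le)
    also have "\<dots> \<le> g (u *\<^sub>R (s + b * x) + v *\<^sub>R (t + b * y)) * log_gamma_weight a (u * x + v * y)"
      using lc uv log_gamma_weight_log_concave[OF uv] pos unfolding log_concave_iff_powr[OF pos]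
      by (intro mult_mono) (auto simp: less_imp_le)
    finally show ?thesis by (simp add: f_def algebra_simps)
  qed
  have "log_concave (\<lambda>t. integral\<^sup>L lborel (f t))"
    unfolding log_concave_iff_powr[of "\<lambda>t. integral\<^sup>L lborel (f t)", OF I_pos]
    using prekopa_leindler_real[OF f_cont f_int f_pos f_cont f_int f_pos f_int] key
    by simp
  then show "log_concave (\<lambda>t. LINT u|lborel. g (t + b * u) * log_gamma_weight a u)"
    unfolding f_def[abs_def] .
  show "integrable lborel (\<lambda>u. g (t + b * u) * log_gamma_weight a u)"
    using f_int[of t] unfolding f_def[abs_def] .
  show "0 < (LINT u|lborel. g (t + b * u) * log_gamma_weight a u)"
    using I_pos[of t] unfolding f_def[abs_def] .
qed

section \<open>The exponential layer-cake formula\<close>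

lemma exp_uminus_eq_nn_integral:
  assumes "0 \<le> c"
  shows "(\<integral>\<^sup>+u. ennreal (log_gamma_weight 0 u) * indicator {u. c \<le> exp u} u \<partial>lborel) = ennreal (exp (- c))"
\<comment> \<open>For \<open>c = 0\<close> the constraint is void and the integral is
  \<open>Gamma 1\<close>; otherwise it starts at \<open>ln c\<close>, with antiderivative
  \<open>- exp (- exp u)\<close>.\<close>
proof (cases "c = 0")
  case True
  then show ?thesis
    using nn_integral_eq_integral[OF integrable_log_gamma_weight[of 0]]
    by (simp add: integral_log_gamma_weight log_gamma_weight_pos less_imp_le)
next
  case False
  then have c: "0 < c" using assms by simp
  have "((\<lambda>u::real. - exp (- exp u)) \<longlongrightarrow> - 0) at_top"
    by (intro tendsto_minus filterlim_compose[OF exp_at_bot]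
      filterlim_compose[OF filterlim_uminus_at_bot_at_top] exp_at_top)
  then have "(\<integral>\<^sup>+u. ennreal (log_gamma_weight 0 u) * indicator {ln c..} u \<partial>lborel) =
    ennreal (0 - (- exp (- exp (ln c))))"
    by (intro nn_integral_FTC_atLeast)
       (auto intro!: derivative_eq_intros simp: log_gamma_weight_def exp_diff exp_minus field_simps)
  moreover have "c \<le> exp u \<longleftrightarrow> ln c \<le> u" for u
    using c exp_le_cancel_iff[of "ln c" u] by simp
  then have "{u. c \<le> exp u} = {ln c..}" by auto
  ultimately show ?thesis using c by simp
qed

text \<open>Each value \<open>exp (- \<phi> x)\<close> is the total weight of those \<open>u\<close>
  with \<open>\<phi> x \<le> exp u\<close>; Tonelli's theorem then exchanges the two
  integrals.\<close>

lemma layer_cake_exp: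
  assumes "sigma_finite_measure M" and [measurable]: "\<phi> \<in> borel_measurable M" and nn: "\<And>x. 0 \<le> \<phi> x"
  shows "(\<integral>\<^sup>+x. ennreal (exp (- \<phi> x)) \<partial>M) =
    (\<integral>\<^sup>+u. ennreal (log_gamma_weight 0 u) * emeasure M {x \<in> space M. \<phi> x \<le> exp u} \<partial>lborel)"
proof -
  interpret M: sigma_finite_measure M by fact
  interpret pair_sigma_finite M "lborel :: real measure" ..
  have "(\<integral>\<^sup>+x. ennreal (exp (- \<phi> x)) \<partial>M) =
    (\<integral>\<^sup>+x. (\<integral>\<^sup>+u. ennreal (log_gamma_weight 0 u) * indicator {u. \<phi> x \<le> exp u} u \<partial>lborel) \<partial>M)"
    by (intro nn_integral_cong exp_uminus_eq_nn_integral[symmetric] nn)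
  also have "\<dots> = (\<integral>\<^sup>+x. (\<integral>\<^sup>+u. ennreal (log_gamma_weight 0 u) *
      indicator {p \<in> space (M \<Otimes>\<^sub>M lborel). \<phi> (fst p) \<le> exp (snd p)} (x, u) \<partial>lborel) \<partial>M)"
    by (intro nn_integral_cong) (auto simp: indicator_def space_pair_measure)
  also have "\<dots> = (\<integral>\<^sup>+u. (\<integral>\<^sup>+x. ennreal (log_gamma_weight 0 u) *
      indicator {p \<in> space (M \<Otimes>\<^sub>M lborel). \<phi> (fst p) \<le> exp (snd p)} (x, u) \<partial>M) \<partial>lborel)"
    by (rule Fubini'[symmetric]) measurable
  also have "\<dots> = (\<integral>\<^sup>+u. (\<integral>\<^sup>+x. ennreal (log_gamma_weight 0 u) *
      indicator {x \<in> space M. \<phi> x \<le> exp u} x \<partial>M) \<partial>lborel)"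
    by (intro nn_integral_cong) (auto simp: indicator_def space_pair_measure)
  also have "\<dots> = (\<integral>\<^sup>+u. ennreal (log_gamma_weight 0 u) * emeasure M {x \<in> space M. \<phi> x \<le> exp u} \<partial>lborel)"
    by (intro nn_integral_cong) (simp add: nn_integral_cmult)
  finally show ?thesis .
qed

section \<open>Gauges and polars of symmetric convex bodies\<close>

lemma symmetric_convex_bodyD:
  assumes "symmetric_convex_body K"
  shows "compact K" "closed K" "bounded K" "convex K" "x \<in> K \<Longrightarrow> - x \<in> K"
proof -
  show "compact K" "closed K" "bounded K" "convex K"
    using assms by (auto simp: symmetric_convex_body_def convex_body_def compact_imp_closed compact_imp_bounded)
  show "- x \<in> K" if "x \<in> K"
    using assms that unfolding symmetric_convex_body_def by blast
qed

text \<open>By symmetry a ball about an interior point \<open>x\<close> has a mirror image about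
  \<open>- x\<close>; midpoints of the two fill a ball about 0.\<close>

lemma symmetric_convex_body_ball:
  assumes K: "symmetric_convex_body K"
  obtains e where "0 < e" "cball 0 e \<subseteq> K"
proof -
  obtain x where "x \<in> interior K"
    using K by (auto simp: symmetric_convex_body_def convex_body_def)
  then obtain e where e: "0 < e" "cball x e \<subseteq> K" by (auto simp: mem_interior_cball)
  have "y \<in> K" if "norm y \<le> e" for y
  proof -
    have "x + y \<in> K" "x - y \<in> K" using e(2) that by (auto simp: subset_iff dist_norm)
    then have "x + y \<in> K" "y - x \<in> K" using symmetric_convex_bodyD(5)[OF K, of "x - y"] by auto
    then have "(1/2) *\<^sub>R (x + y) + (1/2) *\<^sub>R (y - x) \<in> K"
      using symmetric_convex_bodyD(4)[OF K] by (intro convexD) auto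
    also have "(1/2) *\<^sub>R (x + y) + (1/2) *\<^sub>R (y - x) = y"
      by (simp add: algebra_simps flip: scaleR_add_left)
    finally show ?thesis .
  qed
  then show ?thesis using e(1) that[of e] by (auto simp: subset_iff)
qed

lemma symmetric_convex_body_zero: "symmetric_convex_body K \<Longrightarrow> 0 \<in> K"
  by (rule symmetric_convex_body_ball[of K]) (auto simp: subset_iff)

lemma convex_zero_scale_mem:
  assumes "convex K" "0 \<in> K" "x \<in> K" "0 \<le> c" "c \<le> 1"
  shows "c *\<^sub>R x \<in> K"
  using convexD[OF assms(1,3,2), of c "1 - c"] assms by simp

lemma mem_scaleR_image_iff:
  fixes x :: "'a::real_vector"
  assumes "0 < r" shows "x \<in> (\<lambda>y. r *\<^sub>R y) ` K \<longleftrightarrow> (1 / r) *\<^sub>R x \<in> K"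
proof
  assume "(1 / r) *\<^sub>R x \<in> K"
  then show "x \<in> (\<lambda>y. r *\<^sub>R y) ` K"
    using assms by (intro image_eqI[of _ _ "(1 / r) *\<^sub>R x"]) auto
qed (use assms in auto)

text \<open>Gauges will be compared through sublevel sets at positive levels, where division by
  \<open>r\<close> makes sense.\<close>

lemma eq_if_same_positive_upper_bounds:
  fixes a b :: real
  assumes "0 \<le> a" "0 \<le> b" "\<And>r. 0 < r \<Longrightarrow> a \<le> r \<longleftrightarrow> b \<le> r"
  shows "a = b"
proof (rule linorder_cases[of a b])
  assume "a < b"
  then show ?thesis using assms(1) assms(3)[of "(a + b) / 2"] by auto
next
  assume "b < a"
  then show ?thesis using assms(2) assms(3)[of "(a + b) / 2"] by auto
qed

section \<open>Gauges as norms\<close>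

context
  fixes K :: "(real ^ 'n) set"
  assumes K: "symmetric_convex_body K"
begin

text \<open>The admissible scales form an upward closed set, by convexity and
  \<open>0 \<in> K\<close>, and closedness of \<open>K\<close> makes the condition survive at the
  infimum.\<close>

lemma body_norm_le_iff:
  assumes r: "0 < r"
  shows "body_norm K x \<le> r \<longleftrightarrow> (1 / r) *\<^sub>R x \<in> K"
proof -
  define A where "A = {r. 0 < r \<and> (1 / r) *\<^sub>R x \<in> K}"
  have A: "body_norm K x = Inf A"
    unfolding body_norm_def A_def by (intro arg_cong[of _ _ Inf]) (auto simp: mem_scaleR_image_iff)
  have bdd: "bdd_below A" by (intro bdd_belowI[of _ 0]) (auto simp: A_def)
  obtain e where e: "0 < e" "cball 0 e \<subseteq> K" using symmetric_convex_body_ball[OF K] .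
  \<comment> \<open>The summand 1 keeps the scale positive at \<open>x = 0\<close>.\<close>
  have "(norm x + 1) / e \<in> A"
  proof -
    have pos: "0 < norm x + 1" by (simp add: add_nonneg_pos)
    have "e * norm x / (norm x + 1) \<le> e"
      using e pos by (simp add: field_simps)
    then have "(1 / ((norm x + 1) / e)) *\<^sub>R x \<in> cball 0 e"
      using e(1) pos by simp
    then show ?thesis using e pos by (auto simp: A_def)
  qed
  then have ne: "A \<noteq> {}" by auto
  have up: "s \<in> A" if "q \<in> A" "q \<le> s" for q s
  proof -
    have "(q / s) *\<^sub>R ((1 / q) *\<^sub>R x) \<in> K"
    proof (rule convex_zero_scale_mem)
      show "(1 / q) *\<^sub>R x \<in> K" "0 \<le> q / s" "q / s \<le> 1" using that by (auto simp: A_def)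
    qed (use symmetric_convex_bodyD(4)[OF K] symmetric_convex_body_zero[OF K] in auto)
    then show ?thesis using that by (auto simp: A_def)
  qed
  show ?thesis
  proof
    assume "(1 / r) *\<^sub>R x \<in> K"
    then have "r \<in> A" using r by (simp add: A_def)
    then show "body_norm K x \<le> r" unfolding A using bdd by (rule cInf_lower)
  next
    assume le: "body_norm K x \<le> r"
    have "(1 / s) *\<^sub>R x \<in> K" if "r < s" for s
    proof -
      have "Inf A < s" using le that A by simp
      then obtain q where "q \<in> A" "q < s" using cInf_less_iff[OF ne bdd] by auto
      then show ?thesis using up[of q s] by (auto simp: A_def)
    qed
    \<comment> \<open>As \<open>r\<close> may itself be the infimum, it is approached from the
      right, where membership is known.\<close>
    then have ev: "\<forall>\<^sub>F s in at_right r. (1 / s) *\<^sub>R x \<in> K"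
      by (auto simp: eventually_at_right_field intro: exI[of _ "r + 1"])
    have "((\<lambda>s. (1 / s) *\<^sub>R x) \<longlongrightarrow> (1 / r) *\<^sub>R x) (at_right r)"
      using r by (intro tendsto_intros) auto
    then show "(1 / r) *\<^sub>R x \<in> K"
      using Lim_in_closed_set[OF symmetric_convex_bodyD(2)[OF K] ev] by simp
  qed
qed

lemma body_norm_nonneg: "0 \<le> body_norm K x"
proof (rule ccontr)
  assume neg: "\<not> 0 \<le> body_norm K x"
  define A where "A = {r. 0 < r \<and> x \<in> (\<lambda>y. r *\<^sub>R y) ` K}"
  \<comment> \<open>A negative value places 1 in \<open>A\<close>, so the infimum is over a nonempty
    set of positive numbers.\<close>
  have "x \<in> K" using body_norm_le_iff[of 1 x] neg by simp
  then have "1 \<in> A" by (simp add: A_def mem_scaleR_image_iff)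
  then have "0 \<le> Inf A" by (intro cInf_greatest) (blast, simp add: A_def)
  then show False using neg by (simp add: body_norm_def A_def)
qed

lemma body_norm_eqI:
  assumes "0 \<le> N" "\<And>r. 0 < r \<Longrightarrow> N \<le> r \<longleftrightarrow> (1 / r) *\<^sub>R x \<in> K"
  shows "body_norm K x = N"
  using assms body_norm_nonneg body_norm_le_iff by (intro eq_if_same_positive_upper_bounds) auto

lemma body_norm_scaleR:
  assumes "0 \<le> c"
  shows "body_norm K (c *\<^sub>R x) = c * body_norm K x"
proof (cases "c = 0")
  case True
  then show ?thesis
    using symmetric_convex_body_zero[OF K] by (intro body_norm_eqI) auto
next
  case False
  then have c: "0 < c" using assms by simp
  show ?thesis
  proof (rule body_norm_eqI)
    fix r :: real assume r: "0 < r"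
    have "c * body_norm K x \<le> r \<longleftrightarrow> body_norm K x \<le> r / c" using c by (simp add: field_simps)
    also have "\<dots> \<longleftrightarrow> (1 / r) *\<^sub>R c *\<^sub>R x \<in> K" using c r by (subst body_norm_le_iff) auto
    finally show "c * body_norm K x \<le> r \<longleftrightarrow> (1 / r) *\<^sub>R c *\<^sub>R x \<in> K" .
  qed (use c body_norm_nonneg in auto)
qed

lemma body_norm_minus: "body_norm K (- x) = body_norm K x"
  using symmetric_convex_bodyD(5)[OF K] body_norm_le_iff[of _ x]
  by (intro body_norm_eqI body_norm_nonneg) (metis add.inverse_inverse scaleR_minus_right)

lemma body_norm_triangle: "body_norm K (x + y) \<le> body_norm K x + body_norm K y"
proof (rule field_le_epsilon)
  fix d :: real assume d: "0 < d"
  \<comment> \<open>The slack \<open>d / 2\<close> makes both scales positive even where a gauge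
    vanishes; the convex weights will be \<open>s / (s + t)\<close> and
    \<open>t / (s + t)\<close>.\<close>
  define s t where "s = body_norm K x + d / 2" and "t = body_norm K y + d / 2"
  have st: "0 < s" "0 < t"
    using d body_norm_nonneg[of x] body_norm_nonneg[of y] by (auto simp: s_def t_def)
  have "(1 / s) *\<^sub>R x \<in> K" "(1 / t) *\<^sub>R y \<in> K"
    using st d body_norm_le_iff[of s x] body_norm_le_iff[of t y] by (auto simp: s_def t_def)
  then have "(s / (s + t)) *\<^sub>R (1 / s) *\<^sub>R x + (t / (s + t)) *\<^sub>R (1 / t) *\<^sub>R y \<in> K"
    using st symmetric_convex_bodyD(4)[OF K] by (intro convexD) (auto simp flip: add_divide_distrib)
  then have "(1 / (s + t)) *\<^sub>R (x + y) \<in> K" using st by (simp add: scaleR_add_right)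
  then have "body_norm K (x + y) \<le> s + t" using st by (subst body_norm_le_iff) auto
  then show "body_norm K (x + y) \<le> body_norm K x + body_norm K y + d" by (simp add: s_def t_def)
qed

lemma convex_on_body_norm: "convex_on UNIV (body_norm K)"
proof (rule convex_onI)
  fix t :: real and x y assume "0 < t" "t < 1"
  then show "body_norm K ((1 - t) *\<^sub>R x + t *\<^sub>R y) \<le> (1 - t) * body_norm K x + t * body_norm K y"
    using body_norm_triangle[of "(1 - t) *\<^sub>R x" "t *\<^sub>R y"] by (simp add: body_norm_scaleR)
qed auto

lemma continuous_on_body_norm: "continuous_on S (body_norm K)"
  by (rule continuous_on_subset[OF convex_on_continuous[OF open_UNIV convex_on_body_norm]]) simp

section \<open>Polar bodies, support functions and the bipolar theorem\<close>

lemma polar_body_bound: "\<exists>B>0. \<forall>y\<in>polar_body K. norm y \<le> B"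
proof -
  obtain e where e: "0 < e" "cball 0 e \<subseteq> K" using symmetric_convex_body_ball[OF K] .
  have "norm y \<le> 1 / e" if "y \<in> polar_body K" for y
  proof (cases "y = 0")
    case False
    have "(e / norm y) *\<^sub>R y \<in> K" using e False by (auto simp: subset_iff)
    then have "y \<bullet> ((e / norm y) *\<^sub>R y) \<le> 1" using that by (auto simp: polar_body_def)
    then show ?thesis using False e
      by (simp add: power2_norm_eq_inner[symmetric] power2_eq_square field_simps)
  qed (use e in auto)
  then show ?thesis using e by (intro exI[of _ "1 / e"]) auto
qed

text \<open>The polar is an intersection of closed half-spaces. A ball inside \<open>K\<close>
  bounds it, and a norm bound \<open>B\<close> on \<open>K\<close> puts a ball of radius
  \<open>1 / B\<close> inside it.\<close>

lemma symmetric_convex_body_polar: "symmetric_convex_body (polar_body K)"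
  unfolding symmetric_convex_body_def convex_body_def
proof (intro conjI)
  have eq: "polar_body K = (\<Inter>y\<in>K. {x. y \<bullet> x \<le> 1})"
    by (auto simp: polar_body_def inner_commute)
  have "closed (polar_body K)" unfolding eq by (intro closed_INT ballI closed_halfspace_le)
  moreover have "bounded (polar_body K)" using polar_body_bound by (auto simp: bounded_iff)
  ultimately show "compact (polar_body K)" by (simp add: compact_eq_bounded_closed)
  show "convex (polar_body K)" unfolding eq by (intro convex_INT convex_halfspace_le)
  obtain B where B: "0 < B" "\<forall>x\<in>K. norm x \<le> B"
    using symmetric_convex_bodyD(3)[OF K] bounded_pos by blast
  have "ball 0 (1 / B) \<subseteq> polar_body K"
  proof
    fix x :: "real ^ 'n" assume "x \<in> ball 0 (1 / B)"
    then have x: "norm x \<le> 1 / B" by simp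
    have "x \<bullet> y \<le> 1" if "y \<in> K" for y
    proof -
      have "x \<bullet> y \<le> norm x * norm y" by (rule norm_cauchy_schwarz)
      also have "\<dots> \<le> 1 / B * B" using x B that by (intro mult_mono) auto
      finally show ?thesis using B by simp
    qed
    then show "x \<in> polar_body K" by (simp add: polar_body_def)
  qed
  then have "0 \<in> interior (polar_body K)" using B unfolding mem_interior
    by (intro exI[of _ "1 / B"]) auto
  then show "interior (polar_body K) \<noteq> {}" by auto
  have "- x \<in> polar_body K" if "x \<in> polar_body K" for x
  proof -
    have "- x \<bullet> y \<le> 1" if "y \<in> K" for y
      using \<open>x \<in> polar_body K\<close> symmetric_convex_bodyD(5)[OF K that] by (auto simp: polar_body_def)
    then show ?thesis by (simp add: polar_body_def)
  qed
  then show "polar_body K = uminus ` polar_body K" by (force simp: image_iff)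
qed

lemma bdd_above_inner: "bdd_above ((\<lambda>y. x \<bullet> y) ` K)"
proof -
  obtain B where B: "\<forall>x\<in>K. norm x \<le> B"
    using symmetric_convex_bodyD(3)[OF K] bounded_iff by blast
  have "x \<bullet> y \<le> norm x * B" if "y \<in> K" for y
    using norm_cauchy_schwarz[of x y] B that by (meson mult_left_mono norm_ge_zero order_trans)
  then show ?thesis by (intro bdd_aboveI2)
qed

end

text \<open>Both sides have the same positive sublevel sets. The hard inclusion is separation: a
  hyperplane between \<open>K\<close> and an outside point yields, after normalisation, a polar
  vector violating the bound.\<close>

lemma support_fun_polar:
  assumes K: "symmetric_convex_body K"
  shows "support_fun (polar_body K) x = body_norm K x"
proof -
  note P = symmetric_convex_body_polar[OF K]
  note bdd = bdd_above_inner[OF P]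
  have zero: "0 \<in> polar_body K" by (simp add: polar_body_def)
  have h0: "0 \<le> support_fun (polar_body K) x"
    using cSUP_upper[OF zero bdd, of x] by (simp add: support_fun_def)
  have "support_fun (polar_body K) x \<le> r \<longleftrightarrow> body_norm K x \<le> r" if r: "0 < r" for r
  proof -
    have "support_fun (polar_body K) x \<le> r \<longleftrightarrow> (\<forall>y\<in>polar_body K. x \<bullet> y \<le> r)"
      unfolding support_fun_def using zero bdd by (intro cSUP_le_iff) auto
    also have "\<dots> \<longleftrightarrow> (1 / r) *\<^sub>R x \<in> K"
    proof
      assume "(1 / r) *\<^sub>R x \<in> K"
      then show "\<forall>y\<in>polar_body K. x \<bullet> y \<le> r"
        using r by (auto simp: polar_body_def inner_commute field_simps)
    next
      assume le: "\<forall>y\<in>polar_body K. x \<bullet> y \<le> r"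
      show "(1 / r) *\<^sub>R x \<in> K"
      proof (rule ccontr)
        assume "(1 / r) *\<^sub>R x \<notin> K"
        then obtain a b where ab: "a \<bullet> ((1 / r) *\<^sub>R x) < b" "\<forall>y\<in>K. b < a \<bullet> y"
          using separating_hyperplane_closed_point symmetric_convex_bodyD(2,4)[OF K] by blast
        \<comment> \<open>Since \<open>b\<close> is negative, dividing
          \<open>b < a \<bullet> y\<close> by it reverses the inequality and puts
          \<open>(1 / b) *\<^sub>R a\<close> in the polar.\<close>
        have b: "b < 0" using ab(2) symmetric_convex_body_zero[OF K] by force
        have "(1 / b) *\<^sub>R a \<in> polar_body K"
          using ab(2) b by (auto simp: polar_body_def field_simps less_imp_le)
        then have "x \<bullet> ((1 / b) *\<^sub>R a) \<le> r" using le by blast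
        then have "b * r \<le> x \<bullet> a" using b by (simp add: field_simps)
        then show False using ab(1) r by (simp add: field_simps inner_commute)
      qed
    qed
    also have "\<dots> \<longleftrightarrow> body_norm K x \<le> r" using r by (rule body_norm_le_iff[OF K, symmetric])
    finally show ?thesis .
  qed
  then show ?thesis using h0 body_norm_nonneg[OF K] by (intro eq_if_same_positive_upper_bounds) auto
qed

text \<open>Membership in the bipolar says that the support function of the polar is at most 1, and
  that function is the gauge of \<open>K\<close>.\<close>

lemma polar_body_polar:
  assumes K: "symmetric_convex_body K"
  shows "polar_body (polar_body K) = K"
proof -
  have "x \<in> polar_body (polar_body K) \<longleftrightarrow> x \<in> K" for x
  proof -
    have "x \<in> polar_body (polar_body K) \<longleftrightarrow> support_fun (polar_body K) x \<le> 1"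
      unfolding support_fun_def
      using bdd_above_inner[OF symmetric_convex_body_polar[OF K]]
        symmetric_convex_body_zero[OF symmetric_convex_body_polar[OF K]]
      by (subst cSUP_le_iff) (auto simp: polar_body_def[of "polar_body K"])
    then show ?thesis using body_norm_le_iff[OF K, of 1 x] by (simp add: support_fun_polar[OF K])
  qed
  then show ?thesis by blast
qed

text \<open>A point outside \<open>M'\<close> could be separated from it, contradicting the
  inequality in the separating direction. Used both ways, this gives uniqueness in the definite
  description of \<open>Lp_sum\<close>.\<close>

lemma convex_body_subset_of_support_fun_le:
  assumes M: "convex_body M" and M': "convex_body M'"
    and le: "\<And>x. support_fun M x \<le> support_fun M' x"
  shows "M \<subseteq> M'"
proof
  fix x assume x: "x \<in> M"
  show "x \<in> M'"
  proof (rule ccontr)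
    assume "x \<notin> M'"
    then obtain a b where ab: "a \<bullet> x < b" "\<forall>y\<in>M'. b < a \<bullet> y"
      using separating_hyperplane_closed_point[of M' x] M'
      by (auto simp: convex_body_def compact_imp_closed)
    have ne: "M' \<noteq> {}" using M' by (auto simp: convex_body_def)
    have "compact ((\<lambda>y. - a \<bullet> y) ` M)"
      using M by (intro compact_continuous_image continuous_intros) (auto simp: convex_body_def)
    then have bdd: "bdd_above ((\<lambda>y. - a \<bullet> y) ` M)"
      by (intro bounded_imp_bdd_above compact_imp_bounded)
    have "- a \<bullet> x \<le> support_fun M (- a)"
      unfolding support_fun_def using x bdd by (rule cSUP_upper)
    also have "\<dots> \<le> support_fun M' (- a)" by (rule le)
    also have "\<dots> \<le> - b"
      unfolding support_fun_def using ne ab(2) by (intro cSUP_least) (auto simp: less_imp_le)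
    finally show False using ab(1) by simp
  qed
qed

section \<open>The polar of the \<open>L_p\<close> sum as a ball\<close>

lemma powr_mono_iff:
  fixes a b p :: real
  assumes "0 < p" "0 \<le> a" "0 \<le> b"
  shows "a powr p \<le> b powr p \<longleftrightarrow> a \<le> b"
  using assms powr_mono2[of p a b] powr_less_mono2[of p b a] by (metis linorder_not_less less_imp_le)

text \<open>When \<open>x\<close> or \<open>y\<close> is 0, the claim reduces to
  \<open>c powr p \<le> c\<close> for \<open>c\<close> in [0, 1], which holds as
  \<open>p \<ge> 1\<close>.\<close>

lemma powr_convex_nonneg:
  fixes x y :: real
  assumes p: "1 \<le> p" and xy: "0 \<le> x" "0 \<le> y" and uv: "0 \<le> u" "0 \<le> v" "u + v = 1"
  shows "(u * x + v * y) powr p \<le> u * x powr p + v * y powr p"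
proof -
  have le: "(c * z) powr p \<le> c * z powr p" if "0 \<le> c" "c \<le> 1" "0 \<le> z" for c z :: real
  proof (cases "c = 0")
    case False
    then have "c powr p \<le> c powr 1" using that p by (intro powr_mono') auto
    then show ?thesis using that by (simp add: powr_mult mult_right_mono)
  qed simp
  show ?thesis
  proof (cases "x = 0 \<or> y = 0")
    case True
    then show ?thesis using le[of u x] le[of v y] xy uv p by auto
  next
    case False
    then show ?thesis using powr_convex[OF p] xy uv unfolding convex_on_def by auto
  qed
qed

text \<open>The \<open>p\<close>-th power of the gauge of the polar \<open>L_p\<close> sum; without
  the root it is a plain sum over the two bodies and homogeneous of degree \<open>p\<close>.\<close>

definition lp_power :: "real \<Rightarrow> (real ^ 'n) set \<Rightarrow> real \<Rightarrow> (real ^ 'n) set \<Rightarrow> real ^ 'n \<Rightarrow> real" where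
  "lp_power p K b L x = body_norm K x powr p + b * body_norm L x powr p"

context
  fixes p b :: real and K L :: "(real ^ 'n) set"
  assumes p: "1 \<le> p" and b: "0 < b" and K: "symmetric_convex_body K" and L: "symmetric_convex_body L"
begin

lemma lp_power_nonneg: "0 \<le> lp_power p K b L x"
  using b by (simp add: lp_power_def)

lemma continuous_on_lp_power: "continuous_on S (lp_power p K b L)"
proof -
  have "continuous_on S (\<lambda>x. body_norm M x powr p)" if M: "symmetric_convex_body M" for M
    using p body_norm_nonneg[OF M]
    by (intro continuous_on_powr' continuous_on_body_norm[OF M] continuous_on_const) auto
  then show ?thesis
    unfolding lp_power_def[abs_def] using K L
    by (intro continuous_on_add continuous_on_mult_left) auto
qed

lemma lp_power_scaleR: "0 \<le> c \<Longrightarrow> lp_power p K b L (c *\<^sub>R x) = c powr p * lp_power p K b L x"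
  using body_norm_nonneg[OF K, of x] body_norm_nonneg[OF L, of x]
  by (simp add: lp_power_def body_norm_scaleR K L powr_mult algebra_simps)

text \<open>Boundedness comes from containment in \<open>K\<close>, convexity from the triangle
  inequality and convexity of the power, and interior points from the open strict sublevel set,
  which contains 0.\<close>

lemma symmetric_convex_body_lp_ball: "symmetric_convex_body {x. lp_power p K b L x \<le> 1}" (is "symmetric_convex_body ?Q")
  unfolding symmetric_convex_body_def convex_body_def
proof (intro conjI)
  have sub: "?Q \<subseteq> K"
  proof
    fix x assume "x \<in> ?Q"
    then have "body_norm K x powr p + b * body_norm L x powr p \<le> 1" by (simp add: lp_power_def)
    moreover have "0 \<le> b * body_norm L x powr p" using b by simp
    ultimately have "body_norm K x powr p \<le> 1 powr p" by simp
    then have "body_norm K x \<le> 1"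
      using p powr_mono_iff[of p "body_norm K x" 1] by (simp add: body_norm_nonneg[OF K])
    then show "x \<in> K" using body_norm_le_iff[OF K, of 1 x] by simp
  qed
  have "closed ?Q" by (intro closed_Collect_le continuous_on_lp_power continuous_intros)
  then show "compact ?Q"
    using sub symmetric_convex_bodyD(3)[OF K] by (auto simp: compact_eq_bounded_closed intro: bounded_subset)
  show "convex ?Q"
  proof (rule convexI)
    fix x y and u v :: real
    assume xy: "x \<in> ?Q" "y \<in> ?Q" and uv: "0 \<le> u" "0 \<le> v" "u + v = 1"
    have 1: "body_norm M (u *\<^sub>R x + v *\<^sub>R y) powr p \<le> u * body_norm M x powr p + v * body_norm M y powr p"
      if M: "symmetric_convex_body M" for M
    proof -
      have "body_norm M (u *\<^sub>R x + v *\<^sub>R y) powr p \<le> (u * body_norm M x + v * body_norm M y) powr p"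
        using body_norm_triangle[OF M, of "u *\<^sub>R x" "v *\<^sub>R y"] uv p
        by (intro powr_mono2) (auto simp: body_norm_scaleR M body_norm_nonneg)
      also have "\<dots> \<le> u * body_norm M x powr p + v * body_norm M y powr p"
        using p uv by (intro powr_convex_nonneg) (auto simp: M body_norm_nonneg)
      finally show ?thesis .
    qed
    have "lp_power p K b L (u *\<^sub>R x + v *\<^sub>R y) \<le>
      (u * body_norm K x powr p + v * body_norm K y powr p) + b * (u * body_norm L x powr p + v * body_norm L y powr p)"
      unfolding lp_power_def using b 1[OF K] 1[OF L] by (intro add_mono mult_left_mono) auto
    also have "\<dots> = u * lp_power p K b L x + v * lp_power p K b L y"
      by (simp add: lp_power_def algebra_simps)
    also have "\<dots> \<le> u * 1 + v * 1" using xy uv by (intro add_mono mult_left_mono) auto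
    finally show "u *\<^sub>R x + v *\<^sub>R y \<in> ?Q" using uv by simp
  qed
  have "open {x. lp_power p K b L x < 1}" by (intro open_Collect_less continuous_on_lp_power continuous_intros)
  then have "{x. lp_power p K b L x < 1} \<subseteq> interior ?Q" by (intro interior_maximal) auto
  moreover have "lp_power p K b L 0 = 0"
    using lp_power_scaleR[of 0 0] by simp
  ultimately show "interior ?Q \<noteq> {}" by (smt (verit) mem_Collect_eq subset_iff empty_iff)
  have "lp_power p K b L (- x) = lp_power p K b L x" for x
    by (simp add: lp_power_def body_norm_minus K L)
  then show "?Q = uminus ` ?Q"
    by (intro equalityI subsetI) (auto intro: image_eqI[of _ _ "- x" for x])
qed

text \<open>Homogeneity of degree \<open>p\<close> turns the sublevel set at level
  \<open>r powr p\<close> into a dilate of the ball.\<close>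

lemma body_norm_lp_ball:
  "body_norm {x. lp_power p K b L x \<le> 1} x = lp_power p K b L x powr (1 / p)"
proof (rule body_norm_eqI[OF symmetric_convex_body_lp_ball])
  fix r :: real assume r: "0 < r"
  have "lp_power p K b L x powr (1 / p) \<le> r \<longleftrightarrow> lp_power p K b L x powr (1 / p) \<le> (r powr p) powr (1 / p)"
    using r p by (simp add: powr_powr)
  also have "\<dots> \<longleftrightarrow> lp_power p K b L x \<le> r powr p"
    using p by (intro powr_mono_iff) (auto simp: lp_power_nonneg)
  also have "\<dots> \<longleftrightarrow> (1 / r) *\<^sub>R x \<in> {x. lp_power p K b L x \<le> 1}"
    using r by (simp add: lp_power_scaleR powr_divide field_simps)
  finally show "lp_power p K b L x powr (1 / p) \<le> r \<longleftrightarrow> (1 / r) *\<^sub>R x \<in> {x. lp_power p K b L x \<le> 1}" .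
qed auto

text \<open>The polar of the ball has the gauge of the ball as its support function, which is the
  prescribed one, and support functions determine convex bodies. The bipolar theorem then returns
  the ball.\<close>

lemma polar_Lp_sum_polar:
  "polar_body (Lp_sum p 1 (polar_body K) b (polar_body L)) = {x. lp_power p K b L x \<le> 1}" (is "_ = ?Q")
proof -
  note Q = symmetric_convex_body_lp_ball
  have N: "support_fun (polar_body ?Q) x = (1 * body_norm K x powr p + b * body_norm L x powr p) powr (1 / p)" for x
    unfolding support_fun_polar[OF Q] body_norm_lp_ball by (simp add: lp_power_def)
  have "Lp_sum p 1 (polar_body K) b (polar_body L) = polar_body ?Q"
    unfolding Lp_sum_def support_fun_polar[OF K] support_fun_polar[OF L]
  proof (rule the_equality, intro conjI allI)
    show cb: "convex_body (polar_body ?Q)"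
      using symmetric_convex_body_polar[OF Q] by (simp add: symmetric_convex_body_def)
    show "support_fun (polar_body ?Q) x = (1 * body_norm K x powr p + b * body_norm L x powr p) powr (1 / p)" for x
      by (rule N)
    fix M assume "convex_body M \<and> (\<forall>x. support_fun M x = (1 * body_norm K x powr p + b * body_norm L x powr p) powr (1 / p))"
    then show "M = polar_body ?Q"
      using cb N by (intro equalityI convex_body_subset_of_support_fun_le) auto
  qed
  then show ?thesis by (simp add: polar_body_polar[OF Q])
qed

end

section \<open>Volumes of scaled bodies\<close>

lemma compact_scaleR_borel: "compact K \<Longrightarrow> (\<lambda>x. c *\<^sub>R x) ` K \<in> sets borel"
  for K :: "'a::euclidean_space set"
  by (intro borel_closed compact_imp_closed compact_scaling)

lemma emeasure_scaleR_compact: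
  fixes K :: "(real ^ 'n) set"
  assumes "compact K" "0 < c"
  shows "emeasure lborel ((\<lambda>x. c *\<^sub>R x) ` K) = ennreal (c ^ CARD('n) * measure lebesgue K)"
proof -
  have "emeasure lborel ((\<lambda>x. c *\<^sub>R x) ` K) = emeasure lebesgue ((\<lambda>x. c *\<^sub>R x) ` K)"
    using compact_scaleR_borel[OF assms(1)] by simp
  also have "\<dots> = \<bar>c\<bar> ^ CARD('n) * emeasure lebesgue K"
    using emeasure_lebesgue_affine[of c 0 K] by simp
  also have "emeasure lebesgue K = ennreal (measure lebesgue K)"
    using lmeasurable_compact[OF assms(1)] by (simp add: emeasure_eq_measure2)
  finally show ?thesis using assms(2) by (simp add: ennreal_mult)
qed

lemma emeasure_lborel_pos_if_cball:
  fixes A :: "'a::euclidean_space set"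
  assumes "0 < e" "cball 0 e \<subseteq> A" "A \<in> sets borel"
  shows "0 < emeasure lborel A"
proof -
  have "0 < emeasure lborel (cball 0 e :: 'a set)"
    using content_cball_pos[OF assms(1), of "0::'a"] by (simp add: measure_def enn2real_positive_iff)
  also have "\<dots> \<le> emeasure lborel A" using assms by (intro emeasure_mono) auto
  finally show ?thesis .
qed

lemma cball_subset_scaleR_image:
  fixes K :: "'a::real_normed_vector set"
  assumes "cball 0 e \<subseteq> K" "0 < c"
  shows "cball 0 (c * e) \<subseteq> (\<lambda>x. c *\<^sub>R x) ` K"
proof
  fix x :: 'a assume "x \<in> cball 0 (c * e)"
  then have "(1 / c) *\<^sub>R x \<in> cball 0 e" using assms(2) by (simp add: field_simps)
  then show "x \<in> (\<lambda>x. c *\<^sub>R x) ` K" using assms by (subst mem_scaleR_image_iff) auto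
qed

lemma borel_measurable_body_norm: "symmetric_convex_body K \<Longrightarrow> body_norm K \<in> borel_measurable borel"
  by (intro borel_measurable_continuous_onI continuous_on_body_norm)

text \<open>The parameters enter only through \<open>(t + u) / p\<close>, so layer-cake integrals
  run over dilates of a fixed body, the form in which log-concavity is assumed.\<close>

lemma body_norm_powr_sublevel:
  fixes p t u :: real
  assumes M: "symmetric_convex_body M" and p: "0 < p"
  shows "{x. exp (- t) * body_norm M x powr p \<le> exp u} = (\<lambda>x. exp ((t + u) / p) *\<^sub>R x) ` M"
proof -
  have "exp (- t) * body_norm M x powr p \<le> exp u \<longleftrightarrow> x \<in> (\<lambda>x. exp ((t + u) / p) *\<^sub>R x) ` M" for x
  proof -
    have "exp (- t) * body_norm M x powr p \<le> exp u \<longleftrightarrow> body_norm M x powr p \<le> exp (t + u)"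
      by (simp add: exp_minus exp_add field_simps)
    also have "exp (t + u) = exp ((t + u) / p) powr p"
      using p by (simp add: exp_powr_real)
    also have "body_norm M x powr p \<le> exp ((t + u) / p) powr p \<longleftrightarrow> body_norm M x \<le> exp ((t + u) / p)"
      using p by (intro powr_mono_iff) (auto simp: body_norm_nonneg[OF M])
    also have "\<dots> \<longleftrightarrow> x \<in> (\<lambda>x. exp ((t + u) / p) *\<^sub>R x) ` M"
      by (subst mem_scaleR_image_iff) (auto simp: body_norm_le_iff[OF M])
    finally show ?thesis .
  qed
  then show ?thesis by blast
qed

text \<open>The volume factor of a dilation is absorbed into the weight, raising its parameter from
  0 to \<open>n / p\<close>.\<close>

lemma log_gamma_weight_times_exp:
  fixes p t u :: real and n :: nat
  shows "log_gamma_weight 0 u * exp ((t + u) / p) ^ n = exp (t * n / p) * log_gamma_weight (n / p) u"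
proof -
  have "exp ((t + u) / p) ^ n = exp (t * n / p + n / p * u)"
    by (simp add: algebra_simps add_divide_distrib flip: exp_of_nat_mult)
  then show ?thesis by (simp add: log_gamma_weight_def algebra_simps flip: exp_add)
qed

text \<open>The layer-cake slices are dilates of \<open>M\<close>; once their volumes are scaled
  out, the integral over \<open>u\<close> is a Gamma value.\<close>

lemma nn_integral_exp_body_norm_powr:
  fixes M :: "(real ^ 'n) set" and p t :: real
  assumes M: "symmetric_convex_body M" and p: "0 < p"
  shows "(\<integral>\<^sup>+x. ennreal (exp (- (exp (- t) * body_norm M x powr p))) \<partial>lborel) =
    ennreal (exp (t * CARD('n) / p) * Gamma (CARD('n) / p + 1) * measure lebesgue M)"
proof -
  let ?n = "real CARD('n)"
  note [measurable] = borel_measurable_body_norm[OF M]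
  have "(\<integral>\<^sup>+x. ennreal (exp (- (exp (- t) * body_norm M x powr p))) \<partial>lborel) =
    (\<integral>\<^sup>+u. ennreal (log_gamma_weight 0 u) *
      emeasure lborel {x \<in> space lborel. exp (- t) * body_norm M x powr p \<le> exp u} \<partial>lborel)"
    by (rule layer_cake_exp) (auto intro: sigma_finite_lborel)
  also have "\<dots> = (\<integral>\<^sup>+u. ennreal (exp (t * ?n / p) * measure lebesgue M) *
      ennreal (log_gamma_weight (?n / p) u) \<partial>lborel)"
  proof (rule nn_integral_cong)
    fix u
    have "ennreal (log_gamma_weight 0 u) *
        emeasure lborel {x \<in> space lborel. exp (- t) * body_norm M x powr p \<le> exp u} =
      ennreal (log_gamma_weight 0 u * exp ((t + u) / p) ^ CARD('n) * measure lebesgue M)"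
      using symmetric_convex_bodyD(1)[OF M] log_gamma_weight_pos[of 0 u]
      by (simp add: body_norm_powr_sublevel[OF M p] emeasure_scaleR_compact mult.assoc less_imp_le flip: ennreal_mult)
    also have "\<dots> = ennreal (exp (t * ?n / p) * measure lebesgue M) * ennreal (log_gamma_weight (?n / p) u)"
      using log_gamma_weight_pos[of "?n / p" u]
      by (simp add: log_gamma_weight_times_exp mult_ac less_imp_le flip: ennreal_mult)
    finally show "ennreal (log_gamma_weight 0 u) *
        emeasure lborel {x \<in> space lborel. exp (- t) * body_norm M x powr p \<le> exp u} =
      ennreal (exp (t * ?n / p) * measure lebesgue M) * ennreal (log_gamma_weight (?n / p) u)" .
  qed
  also have "\<dots> = ennreal (exp (t * ?n / p) * measure lebesgue M) *
    (\<integral>\<^sup>+u. ennreal (log_gamma_weight (?n / p) u) \<partial>lborel)"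
    by (rule nn_integral_cmult) simp
  also have "(\<integral>\<^sup>+u. ennreal (log_gamma_weight (?n / p) u) \<partial>lborel) = ennreal (Gamma (?n / p + 1))"
    using p by (subst nn_integral_eq_integral)
      (auto simp: integrable_log_gamma_weight integral_log_gamma_weight log_gamma_weight_pos less_imp_le)
  also have "ennreal (exp (t * ?n / p) * measure lebesgue M) * ennreal (Gamma (?n / p + 1)) =
    ennreal (exp (t * ?n / p) * Gamma (?n / p + 1) * measure lebesgue M)"
    using p by (simp add: mult_ac Gamma_real_pos less_imp_le add_pos_pos flip: ennreal_mult)
  finally show ?thesis .
qed

section \<open>The measure with density \<open>exp (- (body_norm L x powr p))\<close>\<close>

definition body_norm_measure :: "real \<Rightarrow> (real ^ 'n) set \<Rightarrow> (real ^ 'n) measure" where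
  "body_norm_measure p L = density lborel (\<lambda>x. ennreal (exp (- (body_norm L x powr p))))"

context
  fixes p :: real and L :: "(real ^ 'n) set"
  assumes p: "0 < p" and L: "symmetric_convex_body L"
begin

lemma sets_body_norm_measure [measurable_cong]: "sets (body_norm_measure p L) = sets borel"
  by (simp add: body_norm_measure_def)

lemma space_body_norm_measure: "space (body_norm_measure p L) = UNIV"
  by (simp add: body_norm_measure_def)

lemma emeasure_body_norm_measure:
  assumes "A \<in> sets borel"
  shows "emeasure (body_norm_measure p L) A = (\<integral>\<^sup>+x. ennreal (exp (- (body_norm L x powr p))) * indicator A x \<partial>lborel)"
  using assms borel_measurable_body_norm[OF L] unfolding body_norm_measure_def
  by (intro emeasure_density) auto

lemma finite_measure_body_norm_measure: "finite_measure (body_norm_measure p L)"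
proof (rule finite_measureI)
  show "emeasure (body_norm_measure p L) (space (body_norm_measure p L)) \<noteq> \<infinity>"
    using nn_integral_exp_body_norm_powr[OF L p, of 0]
    by (simp add: space_body_norm_measure emeasure_body_norm_measure)
qed

text \<open>Hypothesis (i) uses a density over the completed measure \<open>lebesgue\<close>; this
  links it to the Borel version to which the layer-cake formula is applied.\<close>

lemma measure_density_lebesgue_body_norm:
  assumes "A \<in> sets borel"
  shows "measure (density lebesgue (\<lambda>x. ennreal (exp (- (body_norm L x powr p))))) A = measure (body_norm_measure p L) A"
proof -
  have "emeasure (density lebesgue (\<lambda>x. ennreal (exp (- (body_norm L x powr p))))) A =
    (\<integral>\<^sup>+x. ennreal (exp (- (body_norm L x powr p))) * indicator A x \<partial>lebesgue)"
    using assms borel_measurable_body_norm[OF L] by (intro emeasure_density) (auto intro!: measurable_completion)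
  then show ?thesis
    unfolding measure_def by (simp add: nn_integral_completion emeasure_body_norm_measure assms)
qed

text \<open>The density is strictly positive, so a Borel null set of this measure is Lebesgue null
  and contains no ball about 0.\<close>

lemma measure_body_norm_measure_pos:
  assumes "0 < e" "cball 0 e \<subseteq> A" and A: "A \<in> sets borel"
  shows "0 < measure (body_norm_measure p L) A"
proof -
  interpret finite_measure "body_norm_measure p L" by (rule finite_measure_body_norm_measure)
  note [measurable] = borel_measurable_body_norm[OF L] A
  have "emeasure (body_norm_measure p L) A \<noteq> 0"
  proof
    assume "emeasure (body_norm_measure p L) A = 0"
    then have "AE x in lborel. ennreal (exp (- (body_norm L x powr p))) * indicator A x = 0"
      unfolding emeasure_body_norm_measure[OF A] by (subst (asm) nn_integral_0_iff_AE) auto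
    then have "AE x in lborel. x \<notin> A"
      by eventually_elim (auto simp: indicator_def split: if_splits)
    then have "emeasure lborel A = 0"
      using AE_iff_measurable[of A lborel "\<lambda>x. x \<notin> A"] by simp
    then show False using emeasure_lborel_pos_if_cball[OF assms] by simp
  qed
  then show ?thesis by (simp add: emeasure_eq_measure zero_less_measure_iff)
qed

text \<open>This derives (i) from (ii), body by body. The layer-cake slices, under Lebesgue measure
  restricted to a dilate of \<open>M\<close>, are dilates of intersections of \<open>L\<close> with
  dilates of \<open>M\<close>; the resulting convolution preserves log-concavity.\<close>

lemma log_concave_body_norm_measure_if_uniform:
  assumes M: "symmetric_convex_body M"
    and lc: "log_concave (\<lambda>t::real. measure lebesgue (L \<inter> (\<lambda>x. exp t *\<^sub>R x) ` M))"
  shows "log_concave (\<lambda>t::real. measure (body_norm_measure p L) ((\<lambda>x. exp t *\<^sub>R x) ` M))"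
proof -
  define g where "g t = measure lebesgue (L \<inter> (\<lambda>x. exp t *\<^sub>R x) ` M)" for t
  note [measurable] = borel_measurable_body_norm[OF L]
  have cM: "compact M" and cL: "compact L" using M L by (auto simp: symmetric_convex_bodyD)
  have bM: "(\<lambda>x. exp t *\<^sub>R x) ` M \<in> sets borel" for t using compact_scaleR_borel[OF cM] .
  have cLM: "compact (L \<inter> (\<lambda>x. exp t *\<^sub>R x) ` M)" for t
    by (intro compact_Int cL compact_scaling cM)
  have g_pos: "0 < g t" for t
  proof -
    obtain e where e: "0 < e" "cball 0 e \<subseteq> L" using symmetric_convex_body_ball[OF L] .
    obtain d where d: "0 < d" "cball 0 d \<subseteq> M" using symmetric_convex_body_ball[OF M] .
    have "cball 0 (min e (exp t * d)) \<subseteq> L \<inter> (\<lambda>x. exp t *\<^sub>R x) ` M"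
      using e(2) cball_subset_scaleR_image[OF d(2), of "exp t"] by fastforce
    then have "0 < emeasure lborel (L \<inter> (\<lambda>x. exp t *\<^sub>R x) ` M)"
      using e(1) d(1) cLM by (intro emeasure_lborel_pos_if_cball) (auto simp: borel_compact)
    \<comment> \<open>With scale factor 1 the scaling lemma merely converts
      \<open>emeasure lborel\<close> to \<open>measure lebesgue\<close>.\<close>
    then show ?thesis
      using emeasure_scaleR_compact[OF cLM, of 1 t] by (simp add: g_def)
  qed
  have g_bdd: "g t \<le> measure lebesgue L" for t
    unfolding g_def using cL cLM by (intro measure_mono_fmeasurable) (auto simp: lmeasurable_compact fmeasurableD)
  have g_lc: "log_concave g" using lc unfolding g_def[abs_def] .
  let ?n = "real CARD('n)"
  have "measure (body_norm_measure p L) ((\<lambda>x. exp t *\<^sub>R x) ` M) =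
    (LINT u|lborel. g (t + - (1 / p) * u) * log_gamma_weight (?n / p) u)" for t
  proof -
    let ?A = "(\<lambda>x. exp t *\<^sub>R x) ` M"
    let ?D = "density lborel (indicator ?A :: _ \<Rightarrow> ennreal)"
    have emD: "emeasure ?D B = emeasure lborel (?A \<inter> B)" if "B \<in> sets borel" for B
      using that bM[of t] by (simp add: emeasure_density flip: indicator_inter_arith)
    have "emeasure ?D (space ?D) \<noteq> \<infinity>"
      using emD[of UNIV] emeasure_scaleR_compact[OF cM, of "exp t"] by simp
    then interpret D: finite_measure ?D by (rule finite_measureI)
    have "emeasure (body_norm_measure p L) ?A =
      (\<integral>\<^sup>+x. indicator ?A x * ennreal (exp (- (body_norm L x powr p))) \<partial>lborel)"
      by (simp add: emeasure_body_norm_measure bM mult.commute)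
    also have "\<dots> = (\<integral>\<^sup>+x. ennreal (exp (- (body_norm L x powr p))) \<partial>?D)"
      using bM by (intro nn_integral_density[symmetric]) auto
    also have "\<dots> = (\<integral>\<^sup>+u. ennreal (log_gamma_weight 0 u) * emeasure ?D {x \<in> space ?D. body_norm L x powr p \<le> exp u} \<partial>lborel)"
      by (rule layer_cake_exp) (auto intro: D.sigma_finite_measure_axioms)
    also have "\<dots> = (\<integral>\<^sup>+u. ennreal (g (t + - (1 / p) * u) * log_gamma_weight (?n / p) u) \<partial>lborel)"
    proof (rule nn_integral_cong)
      fix u
      have "{x \<in> space ?D. body_norm L x powr p \<le> exp u} = (\<lambda>x. exp (u / p) *\<^sub>R x) ` L"
        using body_norm_powr_sublevel[OF L p, of 0 u] by simp
      then have "emeasure ?D {x \<in> space ?D. body_norm L x powr p \<le> exp u} =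
        emeasure lborel (?A \<inter> (\<lambda>x. exp (u / p) *\<^sub>R x) ` L)"
        using emD[OF compact_scaleR_borel[OF cL, of "exp (u / p)"]] by simp
      \<comment> \<open>Factoring out \<open>exp (u / p)\<close> fixes \<open>L\<close> and moves
        the difference of scales to \<open>M\<close>, as hypothesis (ii) requires.\<close>
      also have "?A \<inter> (\<lambda>x. exp (u / p) *\<^sub>R x) ` L =
        (\<lambda>x. exp (u / p) *\<^sub>R x) ` (L \<inter> (\<lambda>x. exp (t + - (1 / p) * u) *\<^sub>R x) ` M)"
        by (subst image_Int) (auto simp: inj_on_def image_image simp flip: exp_add)
      also have "emeasure lborel \<dots> = ennreal (exp (u / p) ^ CARD('n) * g (t + - (1 / p) * u))"
        unfolding g_def by (rule emeasure_scaleR_compact[OF cLM]) simp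
      finally have "ennreal (log_gamma_weight 0 u) * emeasure ?D {x \<in> space ?D. body_norm L x powr p \<le> exp u} =
        ennreal ((log_gamma_weight 0 u * exp ((0 + u) / p) ^ CARD('n)) * g (t + - (1 / p) * u))"
        using log_gamma_weight_pos[of 0 u] by (simp add: mult.assoc less_imp_le flip: ennreal_mult')
      also have "\<dots> = ennreal (g (t + - (1 / p) * u) * log_gamma_weight (?n / p) u)"
        unfolding log_gamma_weight_times_exp by (simp add: mult.commute)
      finally show "ennreal (log_gamma_weight 0 u) * emeasure ?D {x \<in> space ?D. body_norm L x powr p \<le> exp u} =
        ennreal (g (t + - (1 / p) * u) * log_gamma_weight (?n / p) u)" .
    qed
    also have "\<dots> = ennreal (LINT u|lborel. g (t + - (1 / p) * u) * log_gamma_weight (?n / p) u)"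
      using p g_pos log_gamma_weight_pos
      by (intro nn_integral_eq_integral log_concave_convolution(1)[OF g_pos g_lc g_bdd]) (auto simp: less_imp_le)
    finally show ?thesis
      using log_concave_convolution(2)[OF g_pos g_lc g_bdd, of "?n / p" t "- (1 / p)"] p
      by (simp add: measure_def less_imp_le)
  qed
  then show ?thesis
    using log_concave_convolution(3)[OF g_pos g_lc g_bdd, of "?n / p" "- (1 / p)"] p by simp
qed

end

text \<open>The integral of \<open>exp (- (exp (- t) * body_norm K x powr p + body_norm L x powr
  p))\<close> is computed twice: the gauge of the ball gives a multiple of its volume, and the
  measure of \<open>L\<close> gives a log-concave convolution.\<close>

lemma log_concave_measure_lp_ball:
  fixes p :: real and L :: "(real ^ 'n) set"
  assumes p: "1 \<le> p" and L: "symmetric_convex_body L" and K: "symmetric_convex_body K"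
    and lc: "log_concave (\<lambda>t::real. measure (body_norm_measure p L) ((\<lambda>x. exp t *\<^sub>R x) ` K))"
  shows "log_concave (\<lambda>t::real. measure lebesgue {x. lp_power p K (exp t) L x \<le> 1})"
proof -
  have p0: "0 < p" using p by simp
  interpret finite_measure "body_norm_measure p L" by (rule finite_measure_body_norm_measure[OF p0 L])
  note [measurable] = borel_measurable_body_norm[OF L] borel_measurable_body_norm[OF K]
  define g where "g t = measure (body_norm_measure p L) ((\<lambda>x. exp t *\<^sub>R x) ` K)" for t
  have cK: "compact K" using K by (rule symmetric_convex_bodyD)
  have g_pos: "0 < g t" for t
  proof -
    obtain e where e: "0 < e" "cball 0 e \<subseteq> K" using symmetric_convex_body_ball[OF K] .
    show ?thesis unfolding g_def
      by (rule measure_body_norm_measure_pos[OF p0 L _ cball_subset_scaleR_image[OF e(2)]])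
         (use e(1) compact_scaleR_borel[OF cK] in auto)
  qed
  have g_bdd: "g t \<le> measure (body_norm_measure p L) (space (body_norm_measure p L))" for t
    unfolding g_def by (rule bounded_measure)
  have g_lc: "log_concave g" using lc unfolding g_def[abs_def] .
  \<comment> \<open>The measures of the dilates stay inside \<open>g\<close>, so the weight keeps
    the parameter 0.\<close>
  define H where "H t = (LINT u|lborel. g (t + 1 / p * u) * log_gamma_weight 0 u)" for t
  have H: "0 < H t" "log_concave H" for t
    unfolding H_def[abs_def] by (intro log_concave_convolution(2,3)[OF g_pos g_lc g_bdd] order_refl)+
  define n where "n = real CARD('n)"
  have G: "0 < Gamma (n / p + 1)"
    using p0 by (intro Gamma_real_pos) (simp add: n_def add_nonneg_pos)
  have mass: "exp (t * n / p) * Gamma (n / p + 1) * measure lebesgue {x. lp_power p K (exp t) L x \<le> 1} = H (1 / p * t)" for t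
  proof -
    let ?Q = "{x. lp_power p K (exp t) L x \<le> 1}"
    have Q: "symmetric_convex_body ?Q" using p K L by (intro symmetric_convex_body_lp_ball) auto
    have Qp: "body_norm ?Q x powr p = body_norm K x powr p + exp t * body_norm L x powr p" for x
      using p0 lp_power_nonneg[of "exp t" p K L x]
      by (subst body_norm_lp_ball) (auto simp: p K L powr_powr lp_power_def)
    have "ennreal (exp (t * n / p) * Gamma (n / p + 1) * measure lebesgue ?Q) =
      (\<integral>\<^sup>+x. ennreal (exp (- (exp (- t) * body_norm ?Q x powr p))) \<partial>lborel)"
      unfolding n_def by (rule nn_integral_exp_body_norm_powr[OF Q p0, symmetric])
    \<comment> \<open>The factor \<open>exp (- t)\<close> cancels the coefficient of
      \<open>L\<close>, whose term becomes the density of a fixed measure; \<open>t\<close> remains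
      only with \<open>K\<close>.\<close>
    also have "\<dots> = (\<integral>\<^sup>+x. ennreal (exp (- (body_norm L x powr p))) * ennreal (exp (- (exp (- t) * body_norm K x powr p))) \<partial>lborel)"
      unfolding Qp by (intro nn_integral_cong) (simp add: algebra_simps flip: ennreal_mult exp_add mult.assoc)
    also have "\<dots> = (\<integral>\<^sup>+x. ennreal (exp (- (exp (- t) * body_norm K x powr p))) \<partial>body_norm_measure p L)"
      unfolding body_norm_measure_def by (intro nn_integral_density[symmetric]) auto
    also have "\<dots> = (\<integral>\<^sup>+u. ennreal (log_gamma_weight 0 u) *
      emeasure (body_norm_measure p L) {x \<in> space (body_norm_measure p L). exp (- t) * body_norm K x powr p \<le> exp u} \<partial>lborel)"
      by (rule layer_cake_exp)
         (auto intro: sigma_finite_measure_axioms simp: measurable_cong_sets[OF sets_body_norm_measure[OF p0 L] refl])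
    also have "\<dots> = (\<integral>\<^sup>+u. ennreal (g (1 / p * t + 1 / p * u) * log_gamma_weight 0 u) \<partial>lborel)"
    proof (rule nn_integral_cong)
      fix u
      have "{x \<in> space (body_norm_measure p L). exp (- t) * body_norm K x powr p \<le> exp u} =
        (\<lambda>x. exp (1 / p * t + 1 / p * u) *\<^sub>R x) ` K"
        using body_norm_powr_sublevel[OF K p0, of t u]
        by (simp add: space_body_norm_measure[OF p0 L] add_divide_distrib)
      then show "ennreal (log_gamma_weight 0 u) *
        emeasure (body_norm_measure p L) {x \<in> space (body_norm_measure p L). exp (- t) * body_norm K x powr p \<le> exp u} =
        ennreal (g (1 / p * t + 1 / p * u) * log_gamma_weight 0 u)"
        using log_gamma_weight_pos[of 0 u] g_pos[of "1 / p * t + 1 / p * u"]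
        by (simp add: emeasure_eq_measure g_def ennreal_mult mult.commute less_imp_le)
    qed
    also have "\<dots> = ennreal (H (1 / p * t))"
      unfolding H_def using g_pos log_gamma_weight_pos
      by (intro nn_integral_eq_integral log_concave_convolution(1)[OF g_pos g_lc g_bdd]) (auto simp: less_imp_le)
    finally show ?thesis using H(1)[of "1 / p * t"] G by (subst (asm) ennreal_inj) auto
  qed
  \<comment> \<open>Solving \<open>mass\<close> for the volume leaves a log-affine factor, with the
    Gamma constant written as an exponential.\<close>
  have "measure lebesgue {x. lp_power p K (exp t) L x \<le> 1} =
    exp (- ln (Gamma (n / p + 1)) + - (n / p) * t) * H (1 / p * t)" for t
  proof -
    have "exp (- ln (Gamma (n / p + 1)) + - (n / p) * t) = inverse (exp (t * n / p) * Gamma (n / p + 1))"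
      using G unfolding exp_add exp_minus by (simp add: exp_minus mult.commute)
    then show ?thesis unfolding mass[symmetric] using G by (simp add: field_simps)
  qed
  then show ?thesis using log_concave_times_exp[OF H, of "- ln (Gamma (n / p + 1))" "- (n / p)" "1 / p"] by simp
qed

theorem proposition4p3:
  fixes p :: real and L :: "(real ^ 'n) set"
  assumes "1 \<le> p"
    and "symmetric_convex_body L"
    and "(\<forall>M :: (real ^ 'n) set. symmetric_convex_body M \<longrightarrow>
            log_concave (\<lambda>t::real.
              measure (density lebesgue (\<lambda>x. ennreal (exp (- (body_norm L x powr p)))))
                ((\<lambda>x. exp t *\<^sub>R x) ` M)))
         \<or> (\<forall>M :: (real ^ 'n) set. symmetric_convex_body M \<longrightarrow>
            log_concave (\<lambda>t::real. measure lebesgue (L \<inter> (\<lambda>x. exp t *\<^sub>R x) ` M)))"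
  shows "\<forall>K :: (real ^ 'n) set. symmetric_convex_body K \<longrightarrow>
           log_concave (\<lambda>t::real.
             measure lebesgue (polar_body (Lp_sum p 1 (polar_body K) (exp t) (polar_body L))))"
proof (intro allI impI)
  fix K :: "(real ^ 'n) set" assume K: "symmetric_convex_body K"
  note p = \<open>1 \<le> p\<close> and L = \<open>symmetric_convex_body L\<close>
  have p0: "0 < p" using p by simp
  have "(\<lambda>x. exp t *\<^sub>R x) ` K \<in> sets borel" for t :: real
    using symmetric_convex_bodyD(1)[OF K] by (rule compact_scaleR_borel)
  note eq = measure_density_lebesgue_body_norm[OF p0 L this]
  \<comment> \<open>Hypothesis (i) applies to \<open>K\<close> directly; hypothesis (ii) is first
    turned into it for \<open>K\<close>.\<close>
  have "log_concave (\<lambda>t::real. measure (body_norm_measure p L) ((\<lambda>x. exp t *\<^sub>R x) ` K))"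
    using assms(3)
  proof
    assume "\<forall>M :: (real ^ 'n) set. symmetric_convex_body M \<longrightarrow>
            log_concave (\<lambda>t::real.
              measure (density lebesgue (\<lambda>x. ennreal (exp (- (body_norm L x powr p)))))
                ((\<lambda>x. exp t *\<^sub>R x) ` M))"
    then show ?thesis using K unfolding eq[symmetric] by blast
  next
    assume "\<forall>M :: (real ^ 'n) set. symmetric_convex_body M \<longrightarrow>
            log_concave (\<lambda>t::real. measure lebesgue (L \<inter> (\<lambda>x. exp t *\<^sub>R x) ` M))"
    then show ?thesis using K by (intro log_concave_body_norm_measure_if_uniform[OF p0 L K]) blast
  qed
  then have "log_concave (\<lambda>t::real. measure lebesgue {x. lp_power p K (exp t) L x \<le> 1})"
    by (rule log_concave_measure_lp_ball[OF p L K])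
  then show "log_concave (\<lambda>t::real.
      measure lebesgue (polar_body (Lp_sum p 1 (polar_body K) (exp t) (polar_body L))))"
    using polar_Lp_sum_polar[OF p _ K L] by simp
qed

end
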